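(* Let $n\ge 2$, let $A=(a_{ij})\in M_C$ be a consistent matrix of order $n$, and let $i\ne j$ be indices with $a_{ij}\neq 1$. For real $\delta>0$ let $A^{\delta}$ denote the matrix obtained from $A$ by replacing the entry $a_{ij}$ by $a_{ij}^{\delta}$ and the entry $a_{ji}$ by $a_{ji}^{\delta}$, all other entries being unchanged. Then the function $\delta\mapsto RIC(A^{\delta})$ is non-decreasing for $\delta>1$ and non-increasing for $0<\delta<1$.
   Context: $M_R$ is the set of all real $n\times n$ matrices $A=(a_{ij})$ with $a_{ij}>0$ for all $i,j$ and $a_{ij}=1/a_{ji}$ for all $i,j$ (reciprocal matrices). $M_C\subset M_R$ is the set of all real $n\times n$ matrices with $a_{ij}>0$ for all $i,j$ and $a_{ij}a_{jk}=a_{ik}$ for all $i,j,k$ (consistent matrices). For $A\in M_R$ let $r_i=(a_{i1},\dots,a_{in})$ be its $i$-th row, let $\varphi_{ij}$ be the angle between $r_i$ and $r_j$, so $\cos\varphi_{ij}=\frac{r_i\cdot r_j}{|r_i|\,|r_j|}$ (Euclidean dot product and norm). The row inconsistency index is $RIC(A)=1-\frac{2\sum_{i=1}^{n-1}\sum_{j=i+1}^{n}\cos\varphi_{ij}}{n(n-1)}$. *)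

theory Defs
  imports "HOL-Analysis.Analysis"
begin

definition reciprocal_matrices :: "(real ^ 'n ^ 'n) set" where
  "reciprocal_matrices = {A. (\<forall>i j. A $ i $ j > 0) \<and> (\<forall>i j. A $ i $ j = 1 / A $ j $ i)}"

definition consistent_matrices :: "(real ^ 'n ^ 'n) set" where
  "consistent_matrices =
    {A. (\<forall>i j. A $ i $ j > 0) \<and> (\<forall>i j k. A $ i $ j * A $ j $ k = A $ i $ k)}"

definition row_angle :: "real ^ 'n ^ 'n \<Rightarrow> 'n \<Rightarrow> 'n \<Rightarrow> real" where
  "row_angle A i j = arccos ((row i A \<bullet> row j A) / (norm (row i A) * norm (row j A)))"

text \<open>The linear order on the index type plays the role of the usual order on
  \<open>{1, \<dots>, n}\<close>, where \<open>n = CARD('n)\<close>; the double sum thus runs over all pairs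
  of indices \<open>i < j\<close>.\<close>

definition RIC :: "real ^ 'n::{finite,linorder} ^ 'n::{finite,linorder} \<Rightarrow> real" where
  "RIC A = 1 - 2 * (\<Sum>i\<in>UNIV. \<Sum>j\<in>{i<..}. cos (row_angle A i j)) /
                   (real CARD('n) * (real CARD('n) - 1))"

definition perturb :: "real ^ 'n ^ 'n \<Rightarrow> 'n \<Rightarrow> 'n \<Rightarrow> real \<Rightarrow> real ^ 'n ^ 'n" where
  "perturb A i j \<delta> =
    (\<chi> k l. if (k = i \<and> l = j) \<or> (k = j \<and> l = i) then A $ k $ l powr \<delta> else A $ k $ l)"

lemma consistent_subset_reciprocal:
  "(consistent_matrices :: (real ^ 'n ^ 'n) set) \<subseteq> reciprocal_matrices"
proof
  fix A :: "real ^ 'n ^ 'n"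
  assume "A \<in> consistent_matrices"
  then have pos: "A $ i $ j > 0" and mult: "A $ i $ j * A $ j $ k = A $ i $ k" for i j k
    by (auto simp: consistent_matrices_def)
  have "A $ i $ j = 1 / A $ j $ i" for i j
  proof -
    have "A $ i $ i = 1"
      using mult[of i i i] pos[of i i] by simp
    then show ?thesis
      using mult[of i j i] pos[of j i] by (simp add: field_simps)
  qed
  then show "A \<in> reciprocal_matrices"
    using pos unfolding reciprocal_matrices_def by blast
qed

lemma perturb_reciprocal:
  assumes "A \<in> reciprocal_matrices"
  shows "perturb A i j \<delta> \<in> reciprocal_matrices"
proof -
  have pos: "A $ k $ l > 0" and rec: "A $ k $ l = 1 / A $ l $ k" for k l
    using assms unfolding reciprocal_matrices_def by blast+
  have rec_powr: "A $ k $ l powr \<delta> = 1 / A $ l $ k powr \<delta>" for k l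
    using rec[of k l] pos[of l k] by (simp add: powr_divide)
  have "perturb A i j \<delta> $ k $ l > 0" for k l
    using pos[of k l] by (simp add: perturb_def)
  moreover have "perturb A i j \<delta> $ k $ l = 1 / perturb A i j \<delta> $ l $ k" for k l
  proof (cases "(k = i \<and> l = j) \<or> (k = j \<and> l = i)")
    case True
    then have True': "(l = i \<and> k = j) \<or> (l = j \<and> k = i)" by blast
    show ?thesis
      unfolding perturb_def vec_lambda_beta if_P[OF True] if_P[OF True'] by (rule rec_powr)
  next
    case False
    then have False': "\<not> ((l = i \<and> k = j) \<or> (l = j \<and> k = i))" by blast
    show ?thesis
      unfolding perturb_def vec_lambda_beta if_not_P[OF False] if_not_P[OF False'] by (rule rec)
  qed
  ultimately show ?thesis
    unfolding reciprocal_matrices_def by blast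
qed

end

theory Submission
  imports Defs
begin

text \<open>
  All rows of a consistent matrix are multiples of one vector \<open>v\<close>, here the \<open>i\<close>-th row. Put
  \<open>h = a\<^sub>i\<^sub>j powr (\<delta> - 1)\<close>. Perturbing multiplies one coordinate of row \<open>i\<close> by \<open>h\<close> and one
  coordinate of row \<open>j\<close> by \<open>1 / h\<close>, so up to positive factors every pair of distinct rows is either
  parallel or of the form \<open>p + t\<close>, \<open>p + h t\<close> with \<open>p\<close> orthogonal to \<open>t\<close>. The tangent of
  the angle between such vectors is \<open>\<bar>h - 1\<bar> |p| |t| / (|p|\<^sup>2 + h |t|\<^sup>2)\<close>. Only \<open>|p|\<close> depends
  on \<open>h\<close>, and slowly enough that for \<open>h \<ge> 1\<close> this is non-decreasing in \<open>h\<close>. So each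
  cosine is separately monotone in \<open>h \<ge> 1\<close>. Exchanging \<open>i\<close> and \<open>j\<close> replaces \<open>h\<close> by \<open>1 / h\<close>,
  which makes \<open>h \<ge> 1\<close> no restriction.
\<close>

section \<open>Cosines of pairs of vectors\<close>

definition vector_cos :: "'a::real_inner \<Rightarrow> 'a \<Rightarrow> real" where
  "vector_cos u w = (u \<bullet> w) / (norm u * norm w)"

text \<open>Cauchy-Schwarz keeps the quotient in [-1, 1], where \<open>cos\<close> undoes
  \<open>arccos\<close>; from here on only cosines are compared.\<close>

lemma cos_row_angle: "cos (row_angle A k l) = vector_cos (row k A) (row l A)"
proof -
  have "\<bar>vector_cos (row k A) (row l A)\<bar> \<le> 1"
    using Cauchy_Schwarz_ineq2[of "row k A" "row l A"]
    by (auto simp: vector_cos_def abs_mult divide_le_eq_1)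
  then show ?thesis
    unfolding row_angle_def vector_cos_def by (intro cos_arccos) linarith+
qed

lemma vector_cos_commute: "vector_cos u w = vector_cos w u"
  by (simp add: vector_cos_def inner_commute mult.commute)

lemma vector_cos_scaleR:
  assumes "\<alpha> > 0" "\<beta> > 0"
  shows "vector_cos (\<alpha> *\<^sub>R u) (\<beta> *\<^sub>R w) = vector_cos u w"
  using assms by (simp add: vector_cos_def)

text \<open>Lagrange's identity: the squared product of the norms exceeds the squared inner product
  by |p|^2 (h - 1)^2 |t|^2. In this form the tangent of the angle can be read off.\<close>

lemma vector_cos_orthogonal_shift:
  assumes "p \<bullet> t = 0"
  shows "vector_cos (p + t) (p + h *\<^sub>R t) =
    ((norm p)\<^sup>2 + h * (norm t)\<^sup>2) / sqrt (((norm p)\<^sup>2 + h * (norm t)\<^sup>2)\<^sup>2 + (norm p * (h - 1))\<^sup>2 * (norm t)\<^sup>2)"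
proof -
  have "(p + t) \<bullet> (p + h *\<^sub>R t) = (norm p)\<^sup>2 + h * (norm t)\<^sup>2"
    using assms by (simp add: inner_add_left inner_add_right inner_commute power2_norm_eq_inner)
  moreover have "norm (p + t) * norm (p + h *\<^sub>R t) =
      sqrt (((norm p)\<^sup>2 + (norm t)\<^sup>2) * ((norm p)\<^sup>2 + h\<^sup>2 * (norm t)\<^sup>2))"
    unfolding norm_eq_sqrt_inner real_sqrt_mult[symmetric] using assms
    by (simp add: inner_add_left inner_add_right inner_commute power2_eq_square algebra_simps)
  moreover have "((norm p)\<^sup>2 + (norm t)\<^sup>2) * ((norm p)\<^sup>2 + h\<^sup>2 * (norm t)\<^sup>2) =
      ((norm p)\<^sup>2 + h * (norm t)\<^sup>2)\<^sup>2 + (norm p * (h - 1))\<^sup>2 * (norm t)\<^sup>2"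
    by algebra
  ultimately show ?thesis
    by (simp add: vector_cos_def)
qed

text \<open>The quotients are cosines of angles with tangents \<open>y * sqrt T / x\<close> and
  \<open>y' * sqrt T / x'\<close>. The last hypothesis orders these tangents.\<close>

lemma divide_sqrt_sum_mono:
  fixes x y x' y' T :: real
  assumes "0 < x" "0 < x'" "0 \<le> T" "0 \<le> y" "x' * y \<le> x * y'"
  shows "x' / sqrt (x'\<^sup>2 + y'\<^sup>2 * T) \<le> x / sqrt (x\<^sup>2 + y\<^sup>2 * T)"
proof -
  have "x' * sqrt (x\<^sup>2 + y\<^sup>2 * T) = sqrt (x'\<^sup>2 * (x\<^sup>2 + y\<^sup>2 * T))"
    using assms by (simp add: real_sqrt_mult)
  also have "\<dots> \<le> sqrt (x\<^sup>2 * (x'\<^sup>2 + y'\<^sup>2 * T))"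
  proof -
    have "(x' * y)\<^sup>2 * T \<le> (x * y')\<^sup>2 * T"
      using assms by (intro mult_right_mono power_mono) auto
    then show ?thesis by (simp add: algebra_simps power_mult_distrib)
  qed
  also have "\<dots> = x * sqrt (x'\<^sup>2 + y'\<^sup>2 * T)"
    using assms by (simp add: real_sqrt_mult)
  finally have le: "x' * sqrt (x\<^sup>2 + y\<^sup>2 * T) \<le> x * sqrt (x'\<^sup>2 + y'\<^sup>2 * T)" .
  have "0 < x\<^sup>2 + y\<^sup>2 * T" "0 < x'\<^sup>2 + y'\<^sup>2 * T"
    using assms by (auto intro: add_pos_nonneg)
  then show ?thesis using le by (simp add: divide_simps)
qed

text \<open>The comparison of tangents, multiplied out, splits by powers of \<open>T\<close>. The
  constant terms are \<open>slow\<close> times \<open>P * P'\<close>; the coefficients of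
  \<open>T\<close> compare because \<open>P \<le> P'\<close> and (h - 1) / h grows with
  \<open>h\<close>.\<close>

lemma vector_cos_orthogonal_shift_antimono:
  assumes orth: "p \<bullet> t = 0" "p' \<bullet> t = 0"
    and h: "1 \<le> h" "h \<le> h'"
    and p: "p \<noteq> 0" "norm p \<le> norm p'"
    and slow: "norm p' * (h - 1) \<le> norm p * (h' - 1)"
  shows "vector_cos (p' + t) (p' + h' *\<^sub>R t) \<le> vector_cos (p + t) (p + h *\<^sub>R t)"
proof -
  define P P' T where "P = norm p" "P' = norm p'" "T = (norm t)\<^sup>2"
  have P: "0 < P" "P \<le> P'" and T: "0 \<le> T" and sl: "P' * (h - 1) \<le> P * (h' - 1)"
    using p slow by (auto simp: P_P'_T_def)
  have "P * P' * (P' * (h - 1)) \<le> P * P' * (P * (h' - 1))"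
    using P sl by (intro mult_left_mono) auto
  moreover have "h' * (h - 1) \<le> h * (h' - 1)"
    using h by (simp add: algebra_simps)
  then have "P * (h' * (h - 1)) \<le> P' * (h * (h' - 1))"
    using P h by (elim mult_mono[rotated]) auto
  then have "P * (h' * (h - 1)) * T \<le> P' * (h * (h' - 1)) * T"
    using T by (rule mult_right_mono)
  ultimately have "(P'\<^sup>2 + h' * T) * (P * (h - 1)) \<le> (P\<^sup>2 + h * T) * (P' * (h' - 1))"
    by (simp add: algebra_simps power2_eq_square)
  moreover have "0 < P\<^sup>2 + h * T" "0 < P'\<^sup>2 + h' * T"
    using P T h by (auto intro!: add_pos_nonneg)
  ultimately show ?thesis
    unfolding vector_cos_orthogonal_shift[OF orth(1)] vector_cos_orthogonal_shift[OF orth(2)]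
      P_P'_T_def[symmetric]
    using P T h by (intro divide_sqrt_sum_mono) auto
qed

section \<open>Rows of the perturbed matrix and their cosines\<close>

lemma perturb_commute: "perturb A i j = perturb A j i"
  by (rule ext) (auto simp: perturb_def vec_eq_iff)

lemma consistent_matricesD:
  assumes "A \<in> consistent_matrices"
  shows "A $ k $ l > 0" "A $ k $ l * A $ l $ m = A $ k $ m" "A $ k $ k = 1"
proof -
  have pos: "A $ k $ l > 0" and mult: "A $ k $ l * A $ l $ m = A $ k $ m" for k l m
    using assms by (auto simp: consistent_matrices_def)
  then show "A $ k $ l > 0" "A $ k $ l * A $ l $ m = A $ k $ m" .
  show "A $ k $ k = 1"
    using mult[of k k k] pos[of k k] by simp
qed

lemma axis_nth_neq: "k \<noteq> l \<Longrightarrow> axis k x $ l = 0"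
  by (simp add: axis_def)

text \<open>Unperturbed, row \<open>k\<close> is \<open>A $ k $ i *\<^sub>R v\<close>. In row
  \<open>j\<close> the entry in column \<open>i\<close> is divided by \<open>h\<close>; pulling out
  \<open>A $ j $ i / h\<close> turns this entry into 1 and multiplies the others by
  \<open>h\<close>, so that no reciprocal of \<open>h\<close> is left inside the vector.\<close>

lemma row_perturb:
  fixes A :: "real ^ 'n ^ 'n" and \<delta> :: real
  assumes A: "A \<in> consistent_matrices" and ij: "i \<noteq> j"
  defines "v \<equiv> row i A" and "c \<equiv> A $ i $ j"
  defines "h \<equiv> c powr (\<delta> - 1)"
  shows "k \<noteq> i \<Longrightarrow> k \<noteq> j \<Longrightarrow> row k (perturb A i j \<delta>) = A $ k $ i *\<^sub>R v"
    and "row i (perturb A i j \<delta>) = (v - axis j c) + h *\<^sub>R axis j c"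
    and "row j (perturb A i j \<delta>) = (A $ j $ i / h) *\<^sub>R (h *\<^sub>R (v - axis i 1) + axis i 1)"
proof -
  note D = consistent_matricesD[OF A]
  have c: "c > 0" unfolding c_def by (rule D)
  have h: "h > 0" using c by (simp add: h_def)
  have "c * A $ j $ i = 1" using D by (simp add: c_def)
  then have ji: "A $ j $ i = 1 / c" using c by (simp add: field_simps)
  have pw: "c powr \<delta> = c * h"
    using c by (simp add: h_def powr_diff)
  have pw': "(A $ j $ i) powr \<delta> = A $ j $ i / h"
    using c by (simp add: ji pw powr_divide)
  show "row k (perturb A i j \<delta>) = A $ k $ i *\<^sub>R v" if "k \<noteq> i" "k \<noteq> j"
    using that by (simp add: vec_eq_iff row_def perturb_def v_def D)
  show "row i (perturb A i j \<delta>) = (v - axis j c) + h *\<^sub>R axis j c"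
    using ij by (auto simp: vec_eq_iff row_def perturb_def v_def axis_def c_def[symmetric] pw)
  show "row j (perturb A i j \<delta>) = (A $ j $ i / h) *\<^sub>R (h *\<^sub>R (v - axis i 1) + axis i 1)"
    using ij h by (auto simp: vec_eq_iff row_def perturb_def v_def axis_def pw' D)
qed

text \<open>The cases are the ways in which the pair of rows can meet \<open>i\<close> and
  \<open>j\<close>. Each needs a vector \<open>t\<close> independent of the exponent and an
  orthogonal \<open>p\<close> that may grow with \<open>h\<close>.\<close>

lemma vector_cos_perturb_antimono:
  fixes A :: "real ^ 'n ^ 'n"
  assumes A: "A \<in> consistent_matrices" and ij: "i \<noteq> j" and kl: "k \<noteq> l"
    and h1: "1 \<le> A $ i $ j powr (\<delta> - 1)"
    and hh: "A $ i $ j powr (\<delta> - 1) \<le> A $ i $ j powr (\<delta>' - 1)"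
  shows "vector_cos (row k (perturb A i j \<delta>')) (row l (perturb A i j \<delta>')) \<le>
    vector_cos (row k (perturb A i j \<delta>)) (row l (perturb A i j \<delta>))"
proof -
  define v c h h' where "v = row i A" and "c = A $ i $ j"
    and "h = c powr (\<delta> - 1)" and "h' = c powr (\<delta>' - 1)"
  define B B' where "B = perturb A i j \<delta>" and "B' = perturb A i j \<delta>'"
  note defs = v_def c_def h_def h'_def B_def B'_def
  note D = consistent_matricesD[OF A]
  have h: "1 \<le> h" "h \<le> h'" using h1 hh by (auto simp: defs)
  have c: "c > 0" unfolding c_def by (rule D)
  have v: "v $ i = 1" "v $ j = c" "\<And>m. v $ m > 0"
    by (auto simp: defs row_def D)
  note rows = row_perturb[OF A ij, where \<delta> = \<delta>, folded defs] row_perturb[OF A ij, where \<delta> = \<delta>', folded defs]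
  have parallel: "vector_cos (row k B') (row l B') \<le> vector_cos (row k B) (row l B)"
    if "k \<noteq> i" "k \<noteq> j" "l \<noteq> i" "l \<noteq> j" for k l
    using that by (simp add: rows)
  \<comment> \<open>Here \<open>p\<close> does not depend on \<open>h\<close> either:
    \<open>v\<close> is p + t and row \<open>i\<close> is p + h t.\<close>
  have with_i: "vector_cos (row k B') (row i B') \<le> vector_cos (row k B) (row i B)"
    if k: "k \<noteq> i" "k \<noteq> j" for k
  proof -
    let ?p = "v - axis j c"
    have red: "vector_cos (A $ k $ i *\<^sub>R v) w = vector_cos (?p + axis j c) w" for w
      using vector_cos_scaleR[of "A $ k $ i" 1 v w] D by simp
    have "?p $ i \<noteq> 0" using v ij by (simp add: axis_def)
    then have "?p \<noteq> 0" by (metis zero_index)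
    moreover have "?p \<bullet> axis j c = 0"
      by (simp add: inner_axis v)
    ultimately show ?thesis
      unfolding rows(1)[OF k] rows(4)[OF k] rows(2) rows(5) red
      using h by (intro vector_cos_orthogonal_shift_antimono) (auto intro: mult_left_mono)
  qed
  have with_j: "vector_cos (row k B') (row j B') \<le> vector_cos (row k B) (row j B)"
    if k: "k \<noteq> i" "k \<noteq> j" for k
  proof -
    let ?p = "v - axis i 1"
    \<comment> \<open>Stretching \<open>v\<close> by \<open>x\<close> makes the two vectors agree
      off coordinate \<open>i\<close>. The role of \<open>p\<close> passes to
      \<open>x *\<^sub>R ?p\<close>, whose norm is linear in \<open>x\<close>.\<close>
    have red: "vector_cos (A $ k $ i *\<^sub>R v) ((A $ j $ i / x) *\<^sub>R (x *\<^sub>R ?p + axis i 1)) =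
        vector_cos (x *\<^sub>R ?p + axis i 1) (x *\<^sub>R ?p + x *\<^sub>R axis i 1)" if "x \<ge> 1" for x
    proof -
      have "x *\<^sub>R ?p + x *\<^sub>R axis i 1 = x *\<^sub>R v" by (simp add: algebra_simps)
      then show ?thesis
        using that D(1) vector_cos_scaleR[of 1 x "x *\<^sub>R ?p + axis i 1" v]
        by (simp add: vector_cos_scaleR vector_cos_commute)
    qed
    have "?p $ j \<noteq> 0" using v c ij by (simp add: axis_def)
    then have "?p \<noteq> 0" by (metis zero_index)
    moreover have "?p \<bullet> axis i 1 = 0"
      by (simp add: inner_axis v)
    moreover have "norm (h' *\<^sub>R ?p) * (h - 1) \<le> norm (h *\<^sub>R ?p) * (h' - 1)"
    proof -
      have "norm ?p * (h' * (h - 1)) \<le> norm ?p * (h * (h' - 1))"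
        using h by (intro mult_left_mono) (auto simp: algebra_simps)
      then show ?thesis using h by (simp add: mult_ac)
    qed
    moreover have "norm (h *\<^sub>R ?p) \<le> norm (h' *\<^sub>R ?p)"
      using h by (simp add: mult_right_mono)
    moreover have "h' \<ge> 1" using h by simp
    ultimately show ?thesis
      unfolding rows(1)[OF k] rows(4)[OF k] rows(3) rows(6) red[OF h(1)] red[OF \<open>h' \<ge> 1\<close>]
      using h by (intro vector_cos_orthogonal_shift_antimono) auto
  qed
  \<comment> \<open>After rescaling row \<open>j\<close>, both rows have entries 1 and h c at
    \<open>i\<close> and \<open>j\<close>, which form \<open>?p h\<close>. At all other coordinates
    they differ by the factor \<open>h\<close>, so \<open>?t\<close> is the rest of
    \<open>v\<close>.\<close>
  have i_j: "vector_cos (row i B') (row j B') \<le> vector_cos (row i B) (row j B)"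
  proof -
    let ?t = "v - axis i 1 - axis j c"
    let ?p = "\<lambda>x. axis i 1 + axis j (x * c)"
    have red: "vector_cos ((v - axis j c) + x *\<^sub>R axis j c)
          ((A $ j $ i / x) *\<^sub>R (x *\<^sub>R (v - axis i 1) + axis i 1)) =
        vector_cos (?p x + ?t) (?p x + x *\<^sub>R ?t)" if "x \<ge> 1" for x
    proof -
      have 1: "(v - axis j c) + x *\<^sub>R axis j c = ?p x + ?t"
        using ij by (auto simp: vec_eq_iff axis_def)
      have 2: "x *\<^sub>R (v - axis i 1) + axis i 1 = ?p x + x *\<^sub>R ?t"
        using ij by (auto simp: vec_eq_iff axis_def algebra_simps)
      show ?thesis
        unfolding 1 2 using that D(1)[of j i] vector_cos_scaleR[of 1 "A $ j $ i / x" "?p x + ?t"]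
        by simp
    qed
    have orth: "?p x \<bullet> ?t = 0" for x
      using ij by (simp add: inner_add_left inner_axis' v axis_nth_neq)
    have norm_p: "norm (?p x) = sqrt (1 + (x * c)\<^sup>2)" for x
      using ij by (simp add: norm_eq_sqrt_inner inner_add_left inner_axis' axis_nth_neq power2_eq_square)
    have "?p h $ i \<noteq> 0" using ij by (simp add: axis_def)
    then have "?p h \<noteq> 0" by (metis zero_index)
    moreover have "norm (?p h) \<le> norm (?p h')"
      using h c by (simp add: norm_p power_mono mult_right_mono)
    moreover have "norm (?p h') * (h - 1) \<le> norm (?p h) * (h' - 1)"
    proof -
      \<comment> \<open>Squared, the claim is a sum of two inequalities, one for each term of |p|^2
        = 1 + (h c)^2.\<close>
      have "h' * (h - 1) \<le> h * (h' - 1)"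
        using h by (simp add: algebra_simps)
      then have "(c * (h' * (h - 1)))\<^sup>2 \<le> (c * (h * (h' - 1)))\<^sup>2"
        using h c by (intro power_mono mult_left_mono) auto
      moreover have "(h - 1)\<^sup>2 \<le> (h' - 1)\<^sup>2"
        using h by (intro power_mono) auto
      ultimately have "(1 + (h' * c)\<^sup>2) * (h - 1)\<^sup>2 \<le> (1 + (h * c)\<^sup>2) * (h' - 1)\<^sup>2"
        unfolding distrib_right power_mult_distrib by (simp add: mult_ac)
      then have "sqrt ((1 + (h' * c)\<^sup>2) * (h - 1)\<^sup>2) \<le> sqrt ((1 + (h * c)\<^sup>2) * (h' - 1)\<^sup>2)"
        by (rule real_sqrt_le_mono)
      then show ?thesis
        using h by (simp add: norm_p real_sqrt_mult)
    qed
    moreover have "h' \<ge> 1" using h by simp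
    ultimately show ?thesis
      unfolding rows(2,3,5,6) red[OF h(1)] red[OF \<open>h' \<ge> 1\<close>]
      using h orth by (intro vector_cos_orthogonal_shift_antimono) auto
  qed
  show ?thesis
    unfolding B_def[symmetric] B'_def[symmetric]
    using kl parallel[of k l] with_i[of k] with_i[of l] with_j[of k] with_j[of l] i_j
      vector_cos_commute[of "row k B"] vector_cos_commute[of "row k B'"]
    by metis
qed

section \<open>Monotonicity of the index in the exponent\<close>

lemma RIC_perturb_mono:
  fixes A :: "real ^ 'n::{finite,linorder} ^ 'n::{finite,linorder}"
  assumes "A \<in> consistent_matrices" "i \<noteq> j"
    and "1 \<le> A $ i $ j powr (\<delta> - 1)" "A $ i $ j powr (\<delta> - 1) \<le> A $ i $ j powr (\<delta>' - 1)"
  shows "RIC (perturb A i j \<delta>) \<le> RIC (perturb A i j \<delta>')"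
proof -
  have "(\<Sum>k\<in>UNIV. \<Sum>l\<in>{k<..}. cos (row_angle (perturb A i j \<delta>') k l)) \<le>
      (\<Sum>k\<in>UNIV. \<Sum>l\<in>{k<..}. cos (row_angle (perturb A i j \<delta>) k l))"
    unfolding cos_row_angle using assms by (intro sum_mono vector_cos_perturb_antimono) auto
  moreover have "0 \<le> real CARD('n) * (real CARD('n) - 1)"
  proof -
    have "1 \<le> CARD('n)" by (simp add: Suc_leI)
    then show ?thesis by simp
  qed
  ultimately show ?thesis
    unfolding RIC_def by (intro diff_left_mono divide_right_mono mult_left_mono) auto
qed

theorem proposition9:
  fixes A :: "real ^ 'n::{finite,linorder} ^ 'n::{finite,linorder}" and i j :: 'n
  assumes "CARD('n) \<ge> 2"
    and "A \<in> consistent_matrices"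
    and "i \<noteq> j"
    and "A $ i $ j \<noteq> 1"
  shows "mono_on {1<..} (\<lambda>\<delta>. RIC (perturb A i j \<delta>)) \<and>
         antimono_on {0<..<1} (\<lambda>\<delta>. RIC (perturb A i j \<delta>))"
proof -
  note D = consistent_matricesD[OF assms(2)]
  \<comment> \<open>An entry above 1 gives a factor \<open>h \<ge> 1\<close> that grows with the
    exponent beyond 1.\<close>
  have *: "mono_on {1<..} (\<lambda>\<delta>. RIC (perturb A a b \<delta>)) \<and>
      antimono_on {0<..<1} (\<lambda>\<delta>. RIC (perturb A a b \<delta>))" if ab: "a \<noteq> b" "A $ a $ b > 1" for a b
  proof -
    have inv: "A $ a $ b * A $ b $ a = 1"
      using D(2)[of a b a] D(3) by simp
    have "1 * A $ b $ a < A $ a $ b * A $ b $ a"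
      using ab(2) D(1)[of b a] by (intro mult_strict_right_mono)
    with inv have ba: "A $ b $ a < 1" by simp
    have up: "RIC (perturb A a b \<delta>) \<le> RIC (perturb A a b \<delta>')" if "1 < \<delta>" "\<delta> \<le> \<delta>'" for \<delta> \<delta>'
      using that ab
      by (intro RIC_perturb_mono assms(2)) (auto intro: ge_one_powr_ge_zero powr_mono)
    \<comment> \<open>Below exponent 1 the factor at (a, b) drops below 1. Its reciprocal, the
      factor at (b, a), is at least 1 and grows as the exponent decreases.\<close>
    have down: "RIC (perturb A a b \<delta>') \<le> RIC (perturb A a b \<delta>)" if "\<delta> \<le> \<delta>'" "\<delta>' < 1" for \<delta> \<delta>'
    proof -
      have "A $ b $ a powr 0 \<le> A $ b $ a powr (\<delta>' - 1)"
        using that ba D(1)[of b a] by (intro powr_mono') auto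
      then have "1 \<le> A $ b $ a powr (\<delta>' - 1)"
        using D(1)[of b a] by simp
      moreover have "A $ b $ a powr (\<delta>' - 1) \<le> A $ b $ a powr (\<delta> - 1)"
        using that ba D(1)[of b a] by (intro powr_mono') auto
      ultimately show ?thesis
        unfolding perturb_commute[of A a b] using ab(1)
        by (intro RIC_perturb_mono assms(2)) auto
    qed
    show ?thesis
      using up down by (auto simp: monotone_on_def)
  qed
  show ?thesis
  proof (cases "A $ i $ j > 1")
    case True
    then show ?thesis using * assms(3) by blast
  next
    case False
    \<comment> \<open>An entry below 1 has its reciprocal above 1 at the transposed position, and
      perturbing is symmetric in the two positions.\<close>
    have "A $ i $ j * A $ j $ i < 1 * A $ j $ i"
      using False assms(4) D(1)[of j i] by (intro mult_strict_right_mono) auto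
    then have "A $ j $ i > 1"
      using D(2)[of i j i] D(3) by simp
    then show ?thesis
      using *[of j i] assms(3) unfolding perturb_commute[of A i j] by blast
  qed
qed

end
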